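(* Let $d\in\mathbb{N}$, $m>0$, $T>0$, $\boldsymbol{\mu}_0\in\mathbb{R}^d$, $\sigma_0>0$, and let $$\rho_0(x):=\frac{1}{(2\pi\sigma_0^2)^{d/2}}\exp\Big(-\frac{|x-\boldsymbol{\mu}_0|^2}{2\sigma_0^2}\Big),\qquad x\in\mathbb{R}^d.$$ Let $\boldsymbol{\mu}_\star\in\mathbb{R}^d$, $\sigma_\star>0$, and let $\mu_\star:=\mathcal{N}(\boldsymbol{\mu}_\star,\sigma_\star^2I_d)$. There exists a quadratic initial phase function $\theta_0\colon\mathbb{R}^d\to\mathbb{R}$ of the form $$\theta_0(x)=\frac{m a_0}{2\sigma_0}|x-\boldsymbol{\mu}_0|^2+m\,\mathbf{u}_0\cdot(x-\boldsymbol{\mu}_0)+c_0\qquad(a_0,c_0\in\mathbb{R},\ \mathbf{u}_0\in\mathbb{R}^d)\tag{Q}$$ such that $$[X^{\theta_0}(T;\cdot)]_{\#}(\rho_0\,\mathrm{d}x)=\mu_\star\quad\text{in }\mathcal{P}(\mathbb{R}^d)\tag{R}$$ if and only if $$\sigma_\star\ge\frac{T}{2m\sigma_0}.\tag{B}$$ If (B) holds, then the quadratic initial phase functions of the form (Q) satisfying (R) are precisely the functions $$\theta_{0,\star}^{\pm}(x):=\frac{m a_{0,\star}^{\pm}}{2\sigma_0}|x-\boldsymbol{\mu}_0|^2+m\,\mathbf{u}_{0,\star}\cdot(x-\boldsymbol{\mu}_0)+c_0,\qquad x\in\mathbb{R}^d,$$ where $$\mathbf{u}_{0,\star}:=\frac1T(\boldsymbol{\mu}_\star-\boldsymbol{\mu}_0),\qquad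 a_{0,\star}^{\pm}:=\frac1T\Big(-\sigma_0\pm\Big(\sigma_\star^2-\frac{T^2}{4m^2\sigma_0^2}\Big)^{1/2}\Big),$$ and $c_0\in\mathbb{R}$ is arbitrary. If inequality (B) is strict, the two quadratic coefficients $a_{0,\star}^{\pm}$ are distinct; at equality, they coincide.
   Context: For $\theta_0$ of the form (Q), $X^{\theta_0}\colon[0,T]\times\mathbb{R}^d\to\mathbb{R}^d$ denotes the characteristic flow of the Gaussian solution $(\rho^{\theta_0},\theta^{\theta_0})$ of the free Madelung problem (units $\hbar=1$) $$\partial_t\rho+\tfrac1m\operatorname{div}(\rho\nabla\theta)=0,\qquad \partial_t\theta+\tfrac{1}{2m}|\nabla\theta|^2-\tfrac{1}{2m}\tfrac{\Delta\sqrt\rho}{\sqrt\rho}=0\quad\text{in }\mathbb{R}^d\times(0,T),\qquad \rho(\cdot,0)=\rho_0,\ \theta(\cdot,0)=\theta_0,$$ namely of $$\rho^{\theta_0}(x,t)=\frac{1}{(2\pi\sigma(t)^2)^{d/2}}\exp\Big(-\frac{|x-\boldsymbol{\mu}(t)|^2}{2\sigma(t)^2}\Big),\qquad \theta^{\theta_0}(x,t)=\frac{m\dot\sigma(t)}{2\sigma(t)}|x-\boldsymbol{\mu}(t)|^2+m\,\mathbf{u}_0\cdot(x-\boldsymbol{\mu}(t))+\gamma(t),$$ with $\boldsymbol{\mu}(t)=\boldsymbol{\mu}_0+t\mathbf{u}_0$, $\sigma(t)=\big((\sigma_0+a_0t)^2+\frac{t^2}{4m^2\sigma_0^2}\big)^{1/2}$,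 $\gamma(t)=c_0+\frac m2|\mathbf{u}_0|^2t-\frac{d}{4m}\int_0^t\sigma(\tau)^{-2}\,\mathrm{d}\tau$. That is, with $\mathbf{v}^{\theta_0}:=\frac1m\nabla\theta^{\theta_0}$, $X^{\theta_0}$ is the unique solution of $$\partial_tX^{\theta_0}(t;x)=\mathbf{v}^{\theta_0}(X^{\theta_0}(t;x),t)\ \text{ for }(t,x)\in(0,T)\times\mathbb{R}^d,\qquad X^{\theta_0}(0;x)=x\ \text{ for }x\in\mathbb{R}^d.$$ $\mathcal{P}(\mathbb{R}^d)$ is the set of Borel probability measures on $\mathbb{R}^d$, $\rho_0\,\mathrm{d}x$ is the measure with Lebesgue density $\rho_0$, $F_{\#}\mu$ is the pushforward, and $\mathcal{N}(\boldsymbol{\mu},\sigma^2I_d)$ is the isotropic Gaussian distribution with mean $\boldsymbol{\mu}$ and covariance $\sigma^2I_d$. *)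

theory Defs
  imports "HOL-Analysis.Analysis"
begin

definition gaussian_density :: "'a::euclidean_space \<Rightarrow> real \<Rightarrow> 'a \<Rightarrow> real" where
  "gaussian_density \<mu> s x =
     1 / (2 * pi * s\<^sup>2) powr (real DIM('a) / 2) * exp (- (norm (x - \<mu>))\<^sup>2 / (2 * s\<^sup>2))"

text \<open>The isotropic Gaussian distribution with mean \<open>\<mu>\<close> and covariance \<open>s\<^sup>2\<close> times the identity,
  for \<open>s > 0\<close>; the second argument is the standard deviation, not the variance.\<close>

definition isotropic_gaussian :: "'a::euclidean_space \<Rightarrow> real \<Rightarrow> 'a measure" where
  "isotropic_gaussian \<mu> s = density lborel (\<lambda>x. ennreal (gaussian_density \<mu> s x))"

definition quad_phase ::
    "real \<Rightarrow> 'a::euclidean_space \<Rightarrow> real \<Rightarrow> real \<Rightarrow> 'a \<Rightarrow> real \<Rightarrow> 'a \<Rightarrow> real" where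
  "quad_phase m \<mu>\<^sub>0 \<sigma>\<^sub>0 a\<^sub>0 u\<^sub>0 c\<^sub>0 x =
     m * a\<^sub>0 / (2 * \<sigma>\<^sub>0) * (norm (x - \<mu>\<^sub>0))\<^sup>2 + m * (u\<^sub>0 \<bullet> (x - \<mu>\<^sub>0)) + c\<^sub>0"

definition is_quad_phase :: "real \<Rightarrow> 'a::euclidean_space \<Rightarrow> real \<Rightarrow> ('a \<Rightarrow> real) \<Rightarrow> bool" where
  "is_quad_phase m \<mu>\<^sub>0 \<sigma>\<^sub>0 \<theta>\<^sub>0 \<longleftrightarrow> (\<exists>a\<^sub>0 u\<^sub>0 c\<^sub>0. \<theta>\<^sub>0 = quad_phase m \<mu>\<^sub>0 \<sigma>\<^sub>0 a\<^sub>0 u\<^sub>0 c\<^sub>0)"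

text \<open>For \<open>m, \<sigma>\<^sub>0 > 0\<close> the triple \<open>(a\<^sub>0, u\<^sub>0, c\<^sub>0)\<close> is determined by the function \<open>\<theta>\<^sub>0\<close>.\<close>

definition phase_coeffs ::
    "real \<Rightarrow> 'a::euclidean_space \<Rightarrow> real \<Rightarrow> ('a \<Rightarrow> real) \<Rightarrow> real \<times> 'a \<times> real" where
  "phase_coeffs m \<mu>\<^sub>0 \<sigma>\<^sub>0 \<theta>\<^sub>0 =
     (THE (a\<^sub>0, u\<^sub>0, c\<^sub>0). \<theta>\<^sub>0 = quad_phase m \<mu>\<^sub>0 \<sigma>\<^sub>0 a\<^sub>0 u\<^sub>0 c\<^sub>0)"

definition center :: "'a::euclidean_space \<Rightarrow> 'a \<Rightarrow> real \<Rightarrow> 'a" where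
  "center \<mu>\<^sub>0 u\<^sub>0 t = \<mu>\<^sub>0 + t *\<^sub>R u\<^sub>0"

definition width :: "real \<Rightarrow> real \<Rightarrow> real \<Rightarrow> real \<Rightarrow> real" where
  "width m \<sigma>\<^sub>0 a\<^sub>0 t = sqrt ((\<sigma>\<^sub>0 + a\<^sub>0 * t)\<^sup>2 + t\<^sup>2 / (4 * m\<^sup>2 * \<sigma>\<^sub>0\<^sup>2))"

text \<open>In \<open>phase_offset\<close> the parameter \<open>d\<close> is the space dimension. The integral is only used for
  \<open>t \<ge> 0\<close>.\<close>

definition phase_offset ::
    "nat \<Rightarrow> real \<Rightarrow> real \<Rightarrow> real \<Rightarrow> 'a::euclidean_space \<Rightarrow> real \<Rightarrow> real \<Rightarrow> real" where
  "phase_offset d m \<sigma>\<^sub>0 a\<^sub>0 u\<^sub>0 c\<^sub>0 t =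
     c\<^sub>0 + m / 2 * (norm u\<^sub>0)\<^sup>2 * t
       - real d / (4 * m) * integral {0..t} (\<lambda>\<tau>. 1 / (width m \<sigma>\<^sub>0 a\<^sub>0 \<tau>)\<^sup>2)"

text \<open>The phase \<open>\<theta>(x, t)\<close> of the Gaussian solution \<open>(\<rho>, \<theta>)\<close> of the free Madelung system
  \[ \partial_t\rho + \tfrac1m \mathrm{div}(\rho\nabla\theta) = 0, \qquad
     \partial_t\theta + \tfrac1{2m}|\nabla\theta|^2
       - \tfrac1{2m}\tfrac{\Delta\sqrt\rho}{\sqrt\rho} = 0 \]
  with initial data \<open>gaussian_density \<mu>\<^sub>0 \<sigma>\<^sub>0\<close> and \<open>\<theta>\<^sub>0\<close>; the density at time \<open>t\<close> is
  \<open>gaussian_density (center \<mu>\<^sub>0 u\<^sub>0 t) (width m \<sigma>\<^sub>0 a\<^sub>0 t)\<close>.\<close>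

definition gaussian_phase ::
    "real \<Rightarrow> 'a::euclidean_space \<Rightarrow> real \<Rightarrow> ('a \<Rightarrow> real) \<Rightarrow> 'a \<Rightarrow> real \<Rightarrow> real" where
  "gaussian_phase m \<mu>\<^sub>0 \<sigma>\<^sub>0 \<theta>\<^sub>0 x t =
     (case phase_coeffs m \<mu>\<^sub>0 \<sigma>\<^sub>0 \<theta>\<^sub>0 of (a\<^sub>0, u\<^sub>0, c\<^sub>0) \<Rightarrow>
        m * deriv (width m \<sigma>\<^sub>0 a\<^sub>0) t / (2 * width m \<sigma>\<^sub>0 a\<^sub>0 t) * (norm (x - center \<mu>\<^sub>0 u\<^sub>0 t))\<^sup>2
        + m * (u\<^sub>0 \<bullet> (x - center \<mu>\<^sub>0 u\<^sub>0 t))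
        + phase_offset DIM('a) m \<sigma>\<^sub>0 a\<^sub>0 u\<^sub>0 c\<^sub>0 t)"

definition gradient :: "('a::euclidean_space \<Rightarrow> real) \<Rightarrow> 'a \<Rightarrow> 'a" where
  "gradient f x = (THE D. GDERIV f x :> D)"

definition velocity ::
    "real \<Rightarrow> 'a::euclidean_space \<Rightarrow> real \<Rightarrow> ('a \<Rightarrow> real) \<Rightarrow> 'a \<Rightarrow> real \<Rightarrow> 'a" where
  "velocity m \<mu>\<^sub>0 \<sigma>\<^sub>0 \<theta>\<^sub>0 x t =
     (1 / m) *\<^sub>R gradient (\<lambda>y. gaussian_phase m \<mu>\<^sub>0 \<sigma>\<^sub>0 \<theta>\<^sub>0 y t) x"

text \<open>Trajectories are continuous on the closed interval and solve the equation in its interior;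
  without continuity up to the endpoints neither the initial condition nor the value at time \<open>T\<close>
  would be tied to the equation.\<close>

definition is_flow ::
    "('a::real_normed_vector \<Rightarrow> real \<Rightarrow> 'a) \<Rightarrow> real \<Rightarrow> (real \<Rightarrow> 'a \<Rightarrow> 'a) \<Rightarrow> bool" where
  "is_flow v T X \<longleftrightarrow>
     (\<forall>x. X 0 x = x \<and>
          continuous_on {0..T} (\<lambda>t. X t x) \<and>
          (\<forall>t\<in>{0<..<T}. ((\<lambda>t. X t x) has_vector_derivative v (X t x) t) (at t)))"

text \<open>Fixing the value outside \<open>[0, T]\<close> makes the total function representing the flow on
  \<open>[0, T]\<close> unique.\<close>

definition char_flow ::
    "real \<Rightarrow> real \<Rightarrow> 'a::euclidean_space \<Rightarrow> real \<Rightarrow> ('a \<Rightarrow> real) \<Rightarrow> real \<Rightarrow> 'a \<Rightarrow> 'a" where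
  "char_flow m T \<mu>\<^sub>0 \<sigma>\<^sub>0 \<theta>\<^sub>0 =
     (THE X. is_flow (velocity m \<mu>\<^sub>0 \<sigma>\<^sub>0 \<theta>\<^sub>0) T X \<and> (\<forall>t. t \<notin> {0..T} \<longrightarrow> X t = undefined))"

definition u_star :: "real \<Rightarrow> 'a::euclidean_space \<Rightarrow> 'a \<Rightarrow> 'a" where
  "u_star T \<mu>\<^sub>0 \<mu>\<^sub>s = (1 / T) *\<^sub>R (\<mu>\<^sub>s - \<mu>\<^sub>0)"

definition a_star_plus :: "real \<Rightarrow> real \<Rightarrow> real \<Rightarrow> real \<Rightarrow> real" where
  "a_star_plus m T \<sigma>\<^sub>0 \<sigma>\<^sub>s = 1 / T * (- \<sigma>\<^sub>0 + sqrt (\<sigma>\<^sub>s\<^sup>2 - T\<^sup>2 / (4 * m\<^sup>2 * \<sigma>\<^sub>0\<^sup>2)))"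

definition a_star_minus :: "real \<Rightarrow> real \<Rightarrow> real \<Rightarrow> real \<Rightarrow> real" where
  "a_star_minus m T \<sigma>\<^sub>0 \<sigma>\<^sub>s = 1 / T * (- \<sigma>\<^sub>0 - sqrt (\<sigma>\<^sub>s\<^sup>2 - T\<^sup>2 / (4 * m\<^sup>2 * \<sigma>\<^sub>0\<^sup>2)))"

definition reaches ::
    "real \<Rightarrow> real \<Rightarrow> 'a::euclidean_space \<Rightarrow> real \<Rightarrow> 'a \<Rightarrow> real \<Rightarrow> ('a \<Rightarrow> real) \<Rightarrow> bool" where
  "reaches m T \<mu>\<^sub>0 \<sigma>\<^sub>0 \<mu>\<^sub>s \<sigma>\<^sub>s \<theta>\<^sub>0 \<longleftrightarrow>
     distr (density lborel (\<lambda>x. ennreal (gaussian_density \<mu>\<^sub>0 \<sigma>\<^sub>0 x))) borel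
       (char_flow m T \<mu>\<^sub>0 \<sigma>\<^sub>0 \<theta>\<^sub>0 T)
     = isotropic_gaussian \<mu>\<^sub>s \<sigma>\<^sub>s"

end

theory Submission imports Defs begin

text \<open>The velocity field of the Gaussian solution is affine in space, so along any trajectory
  \<open>(X(t) - \<mu>(t)) / \<sigma>(t)\<close> is constant and the flow at time \<open>T\<close> is the affine map
  \<open>x \<mapsto> \<mu>(T) + (\<sigma>(T) / \<sigma>\<^sub>0) (x - \<mu>\<^sub>0)\<close>. It pushes the initial Gaussian to the one with mean
  \<open>\<mu>(T)\<close> and standard deviation \<open>\<sigma>(T)\<close>, and a Gaussian determines these two parameters. Hence
  the target is reached iff \<open>\<mu>(T)\<close> is the target mean, which fixes \<open>u\<^sub>0\<close>, and \<open>\<sigma>(T)\<close> is the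
  target deviation, which is a quadratic equation for \<open>a\<^sub>0\<close>.\<close>

section \<open>Phase coefficients, width and velocity field\<close>

text \<open>Comparing values at \<open>\<mu>\<^sub>0\<close> gives \<open>c\<close>; adding the
  values at plus and minus a unit vector cancels the linear term and gives \<open>a\<close>; the
  linear forms that remain give \<open>u\<close>. This uniqueness evaluates the definite description
  in \<open>phase_coeffs\<close>.\<close>

lemma phase_coeffs_quad_phase:
  fixes \<mu>\<^sub>0 u\<^sub>0 :: "'a::euclidean_space"
  assumes "m \<noteq> 0" and "\<sigma>\<^sub>0 \<noteq> 0"
  shows "phase_coeffs m \<mu>\<^sub>0 \<sigma>\<^sub>0 (quad_phase m \<mu>\<^sub>0 \<sigma>\<^sub>0 a\<^sub>0 u\<^sub>0 c\<^sub>0) = (a\<^sub>0, u\<^sub>0, c\<^sub>0)"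
proof -
  have inj: "a = a\<^sub>0 \<and> u = u\<^sub>0 \<and> c = c\<^sub>0"
    if eq: "quad_phase m \<mu>\<^sub>0 \<sigma>\<^sub>0 a\<^sub>0 u\<^sub>0 c\<^sub>0 = quad_phase m \<mu>\<^sub>0 \<sigma>\<^sub>0 a u c" for a u c
  proof -
    have ev: "m * a\<^sub>0 / (2 * \<sigma>\<^sub>0) * (norm v)\<^sup>2 + m * (u\<^sub>0 \<bullet> v) + c\<^sub>0 =
        m * a / (2 * \<sigma>\<^sub>0) * (norm v)\<^sup>2 + m * (u \<bullet> v) + c" for v
      using fun_cong[OF eq, of "\<mu>\<^sub>0 + v"] by (simp add: quad_phase_def)
    have c: "c = c\<^sub>0" using ev[of 0] by simp
    obtain b :: 'a where b: "b \<in> Basis" using nonempty_Basis by blast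
    have "m * a\<^sub>0 / (2 * \<sigma>\<^sub>0) = m * a / (2 * \<sigma>\<^sub>0)"
      using ev[of b] ev[of "- b"] b c by (simp del: divide_cancel_right mult_cancel_left)
    then have a: "a = a\<^sub>0" using assms by simp
    have "u\<^sub>0 \<bullet> v = u \<bullet> v" for v using ev[of v] a c assms by simp
    then have "u = u\<^sub>0" by (metis inner_commute vector_eq_rdot)
    with a c show ?thesis by simp
  qed
  show ?thesis
    unfolding phase_coeffs_def
    by (rule the_equality) (use inj in auto)
qed

text \<open>The two squares under the root never vanish together: the second is zero only at time 0,
  where the first is positive.\<close>

lemma width_pos:
  assumes "m \<noteq> 0" and "\<sigma>\<^sub>0 \<noteq> 0"
  shows "width m \<sigma>\<^sub>0 a\<^sub>0 t > 0"
proof (cases "t = 0")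
  case False
  then have "t\<^sup>2 / (4 * m\<^sup>2 * \<sigma>\<^sub>0\<^sup>2) > 0" using assms by simp
  then show ?thesis unfolding width_def by (simp add: add_nonneg_pos)
qed (use assms in \<open>simp add: width_def\<close>)

text \<open>Only differentiability is at stake. The derivative of the width stays symbolic in the
  velocity and in the flow equation, so no closed form of it is carried along.\<close>

lemma DERIV_width:
  assumes "m \<noteq> 0" and "\<sigma>\<^sub>0 \<noteq> 0"
  shows "DERIV (width m \<sigma>\<^sub>0 a\<^sub>0) t :> deriv (width m \<sigma>\<^sub>0 a\<^sub>0) t"
proof -
  have pos: "(\<sigma>\<^sub>0 + a\<^sub>0 * t)\<^sup>2 + t\<^sup>2 / (4 * m\<^sup>2 * \<sigma>\<^sub>0\<^sup>2) > 0"
    using width_pos[OF assms, of a\<^sub>0 t] by (simp add: width_def)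
  have "DERIV (\<lambda>t. (\<sigma>\<^sub>0 + a\<^sub>0 * t)\<^sup>2 + t\<^sup>2 / (4 * m\<^sup>2 * \<sigma>\<^sub>0\<^sup>2)) t
      :> 2 * (\<sigma>\<^sub>0 + a\<^sub>0 * t) * a\<^sub>0 + 2 * t / (4 * m\<^sup>2 * \<sigma>\<^sub>0\<^sup>2)"
    by (auto intro!: derivative_eq_intros simp: assms)
  note d = DERIV_chain2[OF DERIV_real_sqrt[OF pos] this]
  show ?thesis
    unfolding width_def[abs_def] DERIV_imp_deriv[OF d] by (rule d)
qed

lemma gradient_eqI: "GDERIV f x :> D \<Longrightarrow> gradient f x = D"
  unfolding gradient_def gderiv_def
  by (rule the_equality) (auto dest: has_derivative_unique simp: fun_eq_iff vector_eq_ldot)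

lemma velocity_quad_phase:
  fixes \<mu>\<^sub>0 u\<^sub>0 :: "'a::euclidean_space"
  assumes "m \<noteq> 0" and "\<sigma>\<^sub>0 \<noteq> 0"
  shows "velocity m \<mu>\<^sub>0 \<sigma>\<^sub>0 (quad_phase m \<mu>\<^sub>0 \<sigma>\<^sub>0 a\<^sub>0 u\<^sub>0 c\<^sub>0) x t =
    (deriv (width m \<sigma>\<^sub>0 a\<^sub>0) t / width m \<sigma>\<^sub>0 a\<^sub>0 t) *\<^sub>R (x - center \<mu>\<^sub>0 u\<^sub>0 t) + u\<^sub>0"
proof -
  \<comment> \<open>At a fixed time the phase is a quadratic polynomial in space. Its constant term
    \<open>g\<close> absorbs \<open>phase_offset\<close>, whose integral therefore drops out of the
    velocity.\<close>
  have "GDERIV (\<lambda>y. k * (norm (y - p))\<^sup>2 + m * (u\<^sub>0 \<bullet> (y - p)) + g) x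
      :> (2 * k) *\<^sub>R (x - p) + m *\<^sub>R u\<^sub>0" for k g and p :: 'a
    unfolding gderiv_def power2_norm_eq_inner
    by (auto intro!: derivative_eq_intros simp: inner_commute algebra_simps)
  note grad = gradient_eqI[OF this]
  show ?thesis
    unfolding velocity_def gaussian_phase_def phase_coeffs_quad_phase[OF assms] prod.case grad
    using assms by (simp add: scaleR_add_right)
qed

section \<open>The characteristic flow\<close>

text \<open>Direct substitution shows that the affine formula is a flow. Uniqueness comes from the
  conserved quantity rather than from a Lipschitz estimate; together they evaluate the definite
  description in \<open>char_flow\<close>.\<close>

lemma char_flow_quad_phase:
  fixes \<mu>\<^sub>0 u\<^sub>0 :: "'a::euclidean_space"
  assumes "m \<noteq> 0" and "\<sigma>\<^sub>0 > 0" and t: "0 \<le> t" "t \<le> T"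
  shows "char_flow m T \<mu>\<^sub>0 \<sigma>\<^sub>0 (quad_phase m \<mu>\<^sub>0 \<sigma>\<^sub>0 a\<^sub>0 u\<^sub>0 c\<^sub>0) t =
    (\<lambda>x. center \<mu>\<^sub>0 u\<^sub>0 t + (width m \<sigma>\<^sub>0 a\<^sub>0 t / \<sigma>\<^sub>0) *\<^sub>R (x - \<mu>\<^sub>0))"
proof -
  let ?W = "width m \<sigma>\<^sub>0 a\<^sub>0" and ?C = "center \<mu>\<^sub>0 u\<^sub>0"
  let ?v = "velocity m \<mu>\<^sub>0 \<sigma>\<^sub>0 (quad_phase m \<mu>\<^sub>0 \<sigma>\<^sub>0 a\<^sub>0 u\<^sub>0 c\<^sub>0)"
  \<comment> \<open>\<open>Y\<close> is differentiable on the whole time axis, which is convenient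
    for calculus; \<open>Z\<close> cuts it off outside \<open>{0..T}\<close> to meet the
    normalisation in \<open>char_flow\<close>.\<close>
  define Y where "Y = (\<lambda>s x. ?C s + (?W s / \<sigma>\<^sub>0) *\<^sub>R (x - \<mu>\<^sub>0))"
  define Z where "Z = (\<lambda>s. if s \<in> {0..T} then Y s else undefined)"
  have \<sigma>: "\<sigma>\<^sub>0 \<noteq> 0" using assms by simp
  note W = width_pos[OF \<open>m \<noteq> 0\<close> \<sigma>, of a\<^sub>0]
  have W_nz: "?W s \<noteq> 0" for s using W[of s] by simp
  have W0: "?W 0 = \<sigma>\<^sub>0" using assms by (simp add: width_def)
  have C0: "?C 0 = \<mu>\<^sub>0" by (simp add: center_def)
  note dW = DERIV_width[OF \<open>m \<noteq> 0\<close> \<sigma>, of a\<^sub>0]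
  have dC: "(?C has_vector_derivative u\<^sub>0) (at s)" for s
    unfolding center_def[abs_def] by (auto intro!: derivative_eq_intros)
  have cW: "continuous_on S ?W" for S
    using dW by (meson DERIV_isCont continuous_at_imp_continuous_on)
  have cC: "continuous_on S ?C" for S
    unfolding center_def[abs_def] by (intro continuous_intros)
  have cY: "continuous_on S (\<lambda>s. Y s x)" for S x
    unfolding Y_def by (intro continuous_intros cW cC) (use \<sigma> in auto)
  have dY: "((\<lambda>s. Y s x) has_vector_derivative ?v (Y s x) s) (at s)" for s x
  proof -
    have "((\<lambda>s. Y s x) has_vector_derivative (u\<^sub>0 + (deriv ?W s / \<sigma>\<^sub>0) *\<^sub>R (x - \<mu>\<^sub>0))) (at s)"
      unfolding Y_def
      by (rule derivative_eq_intros dC dW refl | use \<sigma> in simp)+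
    moreover have "?v (Y s x) s = u\<^sub>0 + (deriv ?W s / \<sigma>\<^sub>0) *\<^sub>R (x - \<mu>\<^sub>0)"
      using W_nz[of s] by (simp add: velocity_quad_phase[OF \<open>m \<noteq> 0\<close> \<sigma>] Y_def)
    ultimately show ?thesis by simp
  qed
  have flowZ: "is_flow ?v T Z"
    unfolding is_flow_def
  proof (intro allI conjI ballI)
    fix x
    show "Z 0 x = x" using t W0 C0 \<sigma> by (simp add: Z_def Y_def)
    show "continuous_on {0..T} (\<lambda>s. Z s x)"
      using cY[of "{0..T}" x] by (rule continuous_on_eq) (simp add: Z_def)
    fix s assume s: "s \<in> {0<..<T}"
    have "((\<lambda>s. Z s x) has_vector_derivative ?v (Y s x) s) (at s)"
      by (rule has_vector_derivative_transform_within_open[OF dY, of "{0<..<T}"])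
         (use s in \<open>auto simp: Z_def\<close>)
    then show "((\<lambda>s. Z s x) has_vector_derivative ?v (Z s x) s) (at s)"
      using s by (simp add: Z_def)
  qed
  have unique: "X s x = Y s x" if flow: "is_flow ?v T X" and s: "s \<in> {0..T}" for X s x
  proof -
    \<comment> \<open>The displacement from the moving centre, measured in units of the current
      width.\<close>
    let ?f = "\<lambda>s. (1 / ?W s) *\<^sub>R (X s x - ?C s)"
    have X0: "X 0 x = x" and cX: "continuous_on {0..T} (\<lambda>s. X s x)"
      and dX: "\<And>s. s \<in> {0<..<T} \<Longrightarrow>
        ((\<lambda>s. X s x) has_vector_derivative ?v (X s x) s) (at s)"
      using flow unfolding is_flow_def by blast+
    \<comment> \<open>The equation holds only in the open interval, so the endpoints are exceptional
      points, where continuity suffices. Inside, the growth of the displacement cancels the growth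
      of the width.\<close>
    have "?f s = ?f 0"
    proof (rule has_derivative_zero_unique_strong_interval[where k = "{0, T}"])
      show "continuous_on {0..T} ?f"
        by (intro continuous_intros cX cW cC) (use W_nz in auto)
      fix r assume r: "r \<in> {0..T} - {0, T}"
      have "(?f has_vector_derivative
          (1 / ?W r) *\<^sub>R (?v (X r x) r - u\<^sub>0)
          + (- deriv ?W r / (?W r)\<^sup>2) *\<^sub>R (X r x - ?C r)) (at r)"
        by (rule derivative_eq_intros dX dC dW refl
            | use r W_nz[of r] in \<open>simp add: power2_eq_square\<close>)+
      then have "(?f has_vector_derivative 0) (at r)"
        by (simp add: velocity_quad_phase[OF \<open>m \<noteq> 0\<close> \<sigma>] power2_eq_square)
      then show "(?f has_derivative (\<lambda>h. 0)) (at r within {0..T})"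
        by (simp add: has_vector_derivative_def has_derivative_at_withinI)
    qed (use s in auto)
    then have "?W s *\<^sub>R ?f s = (?W s / \<sigma>\<^sub>0) *\<^sub>R (x - \<mu>\<^sub>0)"
      by (simp only: X0 W0 C0 scaleR_scaleR) simp
    then have "X s x - ?C s = (?W s / \<sigma>\<^sub>0) *\<^sub>R (x - \<mu>\<^sub>0)"
      using W_nz[of s] by simp
    then show ?thesis by (simp add: Y_def algebra_simps)
  qed
  have "char_flow m T \<mu>\<^sub>0 \<sigma>\<^sub>0 (quad_phase m \<mu>\<^sub>0 \<sigma>\<^sub>0 a\<^sub>0 u\<^sub>0 c\<^sub>0) = Z"
    unfolding char_flow_def
  proof (rule the_equality)
    show "is_flow ?v T Z \<and> (\<forall>s. s \<notin> {0..T} \<longrightarrow> Z s = undefined)"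
      using flowZ by (simp add: Z_def)
    show "X = Z" if "is_flow ?v T X \<and> (\<forall>s. s \<notin> {0..T} \<longrightarrow> X s = undefined)" for X
      using that unique[of X] by (auto simp: Z_def fun_eq_iff)
  qed
  then show ?thesis using t by (simp add: Z_def Y_def)
qed

section \<open>Isotropic Gaussian measures\<close>

lemma continuous_on_gaussian_density:
  "s \<noteq> 0 \<Longrightarrow> continuous_on A (gaussian_density \<mu> s)"
  unfolding gaussian_density_def[abs_def] by (intro continuous_intros) auto

lemma borel_measurable_gaussian_density [measurable]:
  "gaussian_density \<mu> s \<in> borel_measurable borel"
  unfolding gaussian_density_def[abs_def] by measurable

text \<open>The affine map leaves the exponent unchanged, and its Jacobian
  \<open>k ^ DIM('a)\<close> is exactly the ratio of the two normalising constants.\<close>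

lemma distr_isotropic_gaussian_affine:
  fixes \<mu> \<nu> :: "'a::euclidean_space"
  assumes k: "k > 0" and s: "s > 0"
  shows "distr (isotropic_gaussian \<mu> s) borel (\<lambda>x. \<nu> + k *\<^sub>R (x - \<mu>)) =
    isotropic_gaussian \<nu> (k * s)"
proof -
  let ?A = "\<lambda>x. (\<nu> - k *\<^sub>R \<mu>) + k *\<^sub>R x"
  have A: "(\<lambda>x. \<nu> + k *\<^sub>R (x - \<mu>)) = ?A" by (auto simp: algebra_simps)
  have "(2 * pi * (k * s)\<^sup>2) powr (real DIM('a) / 2) =
      (k\<^sup>2) powr (real DIM('a) / 2) * (2 * pi * s\<^sup>2) powr (real DIM('a) / 2)"
    by (subst powr_mult[symmetric]) (auto simp: power_mult_distrib mult_ac)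
  also have "(k\<^sup>2) powr (real DIM('a) / 2) = k ^ DIM('a)"
    using k powr_powr[of k 2 "real DIM('a) / 2"] by (simp add: powr_realpow)
  finally have const: "(2 * pi * (k * s)\<^sup>2) powr (real DIM('a) / 2) =
      k ^ DIM('a) * (2 * pi * s\<^sup>2) powr (real DIM('a) / 2)" .
  have "?A x - \<nu> = k *\<^sub>R (x - \<mu>)" for x by (simp add: algebra_simps)
  then have "- (norm (?A x - \<nu>))\<^sup>2 / (2 * (k * s)\<^sup>2) = - (norm (x - \<mu>))\<^sup>2 / (2 * s\<^sup>2)" for x
    using k by (simp add: power_mult_distrib)
  then have dens: "k ^ DIM('a) * gaussian_density \<nu> (k * s) (?A x) = gaussian_density \<mu> s x" for x
    using k unfolding gaussian_density_def const by simp
  \<comment> \<open>The computation starts from the target measure: Lebesgue measure is rewritten as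
    a scaled image of itself under \<open>?A\<close>, and the density is then pulled back through
    that image.\<close>
  have "isotropic_gaussian \<nu> (k * s) =
      density (density (distr lborel borel ?A) (\<lambda>_. \<bar>k\<bar> ^ DIM('a)))
        (\<lambda>x. ennreal (gaussian_density \<nu> (k * s) x))"
    unfolding isotropic_gaussian_def using k
    by (subst lborel_affine[of k "\<nu> - k *\<^sub>R \<mu>"]) simp_all
  also have "\<dots> = density (distr lborel borel ?A)
      (\<lambda>x. ennreal (k ^ DIM('a) * gaussian_density \<nu> (k * s) x))"
    using k by (subst density_density_eq) (simp_all add: ennreal_mult')
  also have "\<dots> = distr (density lborel (\<lambda>x. ennreal (gaussian_density \<mu> s x))) borel ?A"
    by (subst density_distr) (simp_all add: dens)
  finally show ?thesis unfolding A isotropic_gaussian_def by simp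
qed

text \<open>Equal measures have densities that agree almost everywhere, and by continuity
  everywhere. The common peak value determines the deviation, and the place where it is attained
  determines the mean.\<close>

lemma isotropic_gaussian_inj:
  fixes \<mu> \<nu> :: "'a::euclidean_space"
  assumes eq: "isotropic_gaussian \<mu> s = isotropic_gaussian \<nu> r" and s: "s > 0" and r: "r > 0"
  shows "\<mu> = \<nu> \<and> s = r"
proof -
  let ?f = "gaussian_density \<mu> s" and ?g = "gaussian_density \<nu> r"
  let ?N = "{x. ?f x \<noteq> ?g x}"
  have nonneg: "gaussian_density p t x \<ge> 0" for p x :: 'a and t
    by (simp add: gaussian_density_def)
  have "AE x in lborel. ennreal (?f x) = ennreal (?g x)"
    using eq unfolding isotropic_gaussian_def
    by (subst (asm) sigma_finite_measure.density_unique_iff[OF sigma_finite_lborel]) auto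
  then have "AE x in lborel. ?f x = ?g x"
    by (simp add: nonneg)
  then have "?N \<in> null_sets lborel"
    by (subst (asm) AE_iff_null) auto
  then have "negligible ?N"
    by (simp add: negligible_iff_null_sets null_sets_completionI)
  moreover have "open ?N"
    using s r by (intro open_Collect_neq continuous_on_gaussian_density) auto
  \<comment> \<open>A nonempty open set has positive Lebesgue measure.\<close>
  ultimately have "?N = {}"
    using open_not_negligible by blast
  then have fg: "?f x = ?g x" for x by blast
  \<comment> \<open>The peak value of a Gaussian density with deviation \<open>t\<close>.\<close>
  define C where "C = (\<lambda>t::real. 1 / (2 * pi * t\<^sup>2) powr (real DIM('a) / 2))"
  have at_mean: "gaussian_density p t p = C t" for p :: 'a and t
    by (simp add: gaussian_density_def C_def)
  have le: "gaussian_density p t x \<le> C t" for p x :: 'a and t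
    unfolding gaussian_density_def C_def by (intro mult_left_le) auto
  \<comment> \<open>Evaluating at each of the two means bounds each peak by the other.\<close>
  have CC: "C s = C r"
    using fg[of \<mu>] fg[of \<nu>] le[of \<nu> r \<mu>] le[of \<mu> s \<nu>] by (simp add: at_mean)
  have "(2 * pi * s\<^sup>2) powr (real DIM('a) / 2) = (2 * pi * r\<^sup>2) powr (real DIM('a) / 2)"
    using CC by (simp add: C_def)
  \<comment> \<open>The power \<open>2 / real DIM('a)\<close> undoes the exponent in the normalising
    constant.\<close>
  then have "((2 * pi * s\<^sup>2) powr (real DIM('a) / 2)) powr (2 / real DIM('a)) =
      ((2 * pi * r\<^sup>2) powr (real DIM('a) / 2)) powr (2 / real DIM('a))" by simp
  then have "2 * pi * s\<^sup>2 = 2 * pi * r\<^sup>2"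
    by (simp add: powr_powr)
  then have sr: "s = r" using s r by simp
  have "C r \<noteq> 0" using r by (simp add: C_def)
  moreover have "C r = C r * exp (- (norm (\<mu> - \<nu>))\<^sup>2 / (2 * r\<^sup>2))"
    using fg[of \<mu>] CC at_mean[of \<mu> s] by (simp add: gaussian_density_def C_def)
  ultimately have "exp (- (norm (\<mu> - \<nu>))\<^sup>2 / (2 * r\<^sup>2)) = 1" by simp
  then have "\<mu> = \<nu>" using r by simp
  with sr show ?thesis by simp
qed

section \<open>Solving for the initial phase\<close>

text \<open>Both widths are positive, so the width equation may be squared. Isolating the square
  that contains \<open>a\<^sub>0\<close> reduces solvability to the sign of the other side.\<close>

lemma reaches_quad_phase_iff:
  fixes \<mu>\<^sub>0 \<mu>\<^sub>s u\<^sub>0 :: "'a::euclidean_space"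
  assumes "m \<noteq> 0" and "T > 0" and "\<sigma>\<^sub>0 > 0" and "\<sigma>\<^sub>s > 0"
  shows "reaches m T \<mu>\<^sub>0 \<sigma>\<^sub>0 \<mu>\<^sub>s \<sigma>\<^sub>s (quad_phase m \<mu>\<^sub>0 \<sigma>\<^sub>0 a\<^sub>0 u\<^sub>0 c\<^sub>0) \<longleftrightarrow>
    u\<^sub>0 = u_star T \<mu>\<^sub>0 \<mu>\<^sub>s \<and> (\<sigma>\<^sub>0 + a\<^sub>0 * T)\<^sup>2 = \<sigma>\<^sub>s\<^sup>2 - T\<^sup>2 / (4 * m\<^sup>2 * \<sigma>\<^sub>0\<^sup>2)"
proof -
  let ?W = "width m \<sigma>\<^sub>0 a\<^sub>0 T" and ?C = "center \<mu>\<^sub>0 u\<^sub>0 T"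
  have W: "?W > 0" using assms by (intro width_pos) auto
  have "distr (isotropic_gaussian \<mu>\<^sub>0 \<sigma>\<^sub>0) borel
      (char_flow m T \<mu>\<^sub>0 \<sigma>\<^sub>0 (quad_phase m \<mu>\<^sub>0 \<sigma>\<^sub>0 a\<^sub>0 u\<^sub>0 c\<^sub>0) T) = isotropic_gaussian ?C ?W"
    using assms W distr_isotropic_gaussian_affine[of "?W / \<sigma>\<^sub>0" \<sigma>\<^sub>0 \<mu>\<^sub>0 ?C]
    by (simp add: char_flow_quad_phase)
  then have "reaches m T \<mu>\<^sub>0 \<sigma>\<^sub>0 \<mu>\<^sub>s \<sigma>\<^sub>s (quad_phase m \<mu>\<^sub>0 \<sigma>\<^sub>0 a\<^sub>0 u\<^sub>0 c\<^sub>0) \<longleftrightarrow>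
      ?C = \<mu>\<^sub>s \<and> ?W = \<sigma>\<^sub>s"
    unfolding reaches_def isotropic_gaussian_def[symmetric]
    using isotropic_gaussian_inj[OF _ W \<open>\<sigma>\<^sub>s > 0\<close>] by auto
  moreover have "?C = \<mu>\<^sub>s \<longleftrightarrow> u\<^sub>0 = u_star T \<mu>\<^sub>0 \<mu>\<^sub>s"
    using \<open>T > 0\<close> by (auto simp: center_def u_star_def)
  moreover have "?W = \<sigma>\<^sub>s \<longleftrightarrow> ?W\<^sup>2 = \<sigma>\<^sub>s\<^sup>2"
    using W assms by (simp add: power2_eq_iff_nonneg)
  moreover have "?W\<^sup>2 = (\<sigma>\<^sub>0 + a\<^sub>0 * T)\<^sup>2 + T\<^sup>2 / (4 * m\<^sup>2 * \<sigma>\<^sub>0\<^sup>2)"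
    by (simp add: width_def)
  ultimately show ?thesis by auto
qed

text \<open>The subtracted term is the square of \<open>T / (2 * m * \<sigma>\<^sub>0)\<close>, so
  both claims compare squares of nonnegative numbers.\<close>

lemma discriminant_sign_iff:
  fixes m T \<sigma>\<^sub>0 \<sigma>\<^sub>s :: real
  assumes "m > 0" and "T > 0" and "\<sigma>\<^sub>0 > 0" and "\<sigma>\<^sub>s > 0"
  shows "\<sigma>\<^sub>s\<^sup>2 - T\<^sup>2 / (4 * m\<^sup>2 * \<sigma>\<^sub>0\<^sup>2) \<ge> 0 \<longleftrightarrow> \<sigma>\<^sub>s \<ge> T / (2 * m * \<sigma>\<^sub>0)"
    and "\<sigma>\<^sub>s\<^sup>2 - T\<^sup>2 / (4 * m\<^sup>2 * \<sigma>\<^sub>0\<^sup>2) = 0 \<longleftrightarrow> \<sigma>\<^sub>s = T / (2 * m * \<sigma>\<^sub>0)"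
proof -
  have sq: "T\<^sup>2 / (4 * m\<^sup>2 * \<sigma>\<^sub>0\<^sup>2) = (T / (2 * m * \<sigma>\<^sub>0))\<^sup>2"
    by (simp add: power_divide power_mult_distrib)
  have nonneg: "T / (2 * m * \<sigma>\<^sub>0) \<ge> 0" using assms by simp
  show "\<sigma>\<^sub>s\<^sup>2 - T\<^sup>2 / (4 * m\<^sup>2 * \<sigma>\<^sub>0\<^sup>2) \<ge> 0 \<longleftrightarrow> \<sigma>\<^sub>s \<ge> T / (2 * m * \<sigma>\<^sub>0)"
    unfolding sq using nonneg assms power2_le_iff_abs_le[of \<sigma>\<^sub>s "T / (2 * m * \<sigma>\<^sub>0)"] by simp
  show "\<sigma>\<^sub>s\<^sup>2 - T\<^sup>2 / (4 * m\<^sup>2 * \<sigma>\<^sub>0\<^sup>2) = 0 \<longleftrightarrow> \<sigma>\<^sub>s = T / (2 * m * \<sigma>\<^sub>0)"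
    unfolding sq using nonneg assms by (simp only: right_minus_eq) (rule power2_eq_iff_nonneg, auto)
qed

text \<open>Nonnegativity makes the right-hand side the square of its own root, and equal squares
  differ by a sign.\<close>

lemma a_star_iff:
  assumes "T > 0" and "\<sigma>\<^sub>s\<^sup>2 - T\<^sup>2 / (4 * m\<^sup>2 * \<sigma>\<^sub>0\<^sup>2) \<ge> 0"
  shows "(\<sigma>\<^sub>0 + a * T)\<^sup>2 = \<sigma>\<^sub>s\<^sup>2 - T\<^sup>2 / (4 * m\<^sup>2 * \<sigma>\<^sub>0\<^sup>2) \<longleftrightarrow>
    a = a_star_plus m T \<sigma>\<^sub>0 \<sigma>\<^sub>s \<or> a = a_star_minus m T \<sigma>\<^sub>0 \<sigma>\<^sub>s"
proof -
  define D where "D = \<sigma>\<^sub>s\<^sup>2 - T\<^sup>2 / (4 * m\<^sup>2 * \<sigma>\<^sub>0\<^sup>2)"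
  have "(\<sigma>\<^sub>0 + a * T)\<^sup>2 = D \<longleftrightarrow> (\<sigma>\<^sub>0 + a * T)\<^sup>2 = (sqrt D)\<^sup>2"
    using assms by (simp add: D_def)
  also have "\<dots> \<longleftrightarrow> \<sigma>\<^sub>0 + a * T = sqrt D \<or> \<sigma>\<^sub>0 + a * T = - sqrt D"
    by (rule power2_eq_iff)
  also have "\<dots> \<longleftrightarrow> a = 1 / T * (- \<sigma>\<^sub>0 + sqrt D) \<or> a = 1 / T * (- \<sigma>\<^sub>0 - sqrt D)"
    using assms by (auto simp: field_simps)
  finally show ?thesis by (simp add: a_star_plus_def a_star_minus_def D_def)
qed

theorem theorem3p2:
  fixes m T \<sigma>\<^sub>0 \<sigma>\<^sub>s :: real and \<mu>\<^sub>0 \<mu>\<^sub>s :: "real ^ 'n"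
  assumes "m > 0" and "T > 0" and "\<sigma>\<^sub>0 > 0" and "\<sigma>\<^sub>s > 0"
  shows "((\<exists>\<theta>\<^sub>0. is_quad_phase m \<mu>\<^sub>0 \<sigma>\<^sub>0 \<theta>\<^sub>0 \<and> reaches m T \<mu>\<^sub>0 \<sigma>\<^sub>0 \<mu>\<^sub>s \<sigma>\<^sub>s \<theta>\<^sub>0)
           \<longleftrightarrow> \<sigma>\<^sub>s \<ge> T / (2 * m * \<sigma>\<^sub>0))
       \<and> (\<sigma>\<^sub>s \<ge> T / (2 * m * \<sigma>\<^sub>0) \<longrightarrow>
            {\<theta>\<^sub>0. is_quad_phase m \<mu>\<^sub>0 \<sigma>\<^sub>0 \<theta>\<^sub>0 \<and> reaches m T \<mu>\<^sub>0 \<sigma>\<^sub>0 \<mu>\<^sub>s \<sigma>\<^sub>s \<theta>\<^sub>0}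
            = {quad_phase m \<mu>\<^sub>0 \<sigma>\<^sub>0 a (u_star T \<mu>\<^sub>0 \<mu>\<^sub>s) c\<^sub>0 | a c\<^sub>0.
                 a = a_star_plus m T \<sigma>\<^sub>0 \<sigma>\<^sub>s \<or> a = a_star_minus m T \<sigma>\<^sub>0 \<sigma>\<^sub>s})
       \<and> (\<sigma>\<^sub>s > T / (2 * m * \<sigma>\<^sub>0) \<longrightarrow> a_star_plus m T \<sigma>\<^sub>0 \<sigma>\<^sub>s \<noteq> a_star_minus m T \<sigma>\<^sub>0 \<sigma>\<^sub>s)
       \<and> (\<sigma>\<^sub>s = T / (2 * m * \<sigma>\<^sub>0) \<longrightarrow> a_star_plus m T \<sigma>\<^sub>0 \<sigma>\<^sub>s = a_star_minus m T \<sigma>\<^sub>0 \<sigma>\<^sub>s)"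
proof -
  let ?D = "\<sigma>\<^sub>s\<^sup>2 - T\<^sup>2 / (4 * m\<^sup>2 * \<sigma>\<^sub>0\<^sup>2)"
  let ?S = "{\<theta>\<^sub>0. is_quad_phase m \<mu>\<^sub>0 \<sigma>\<^sub>0 \<theta>\<^sub>0 \<and> reaches m T \<mu>\<^sub>0 \<sigma>\<^sub>0 \<mu>\<^sub>s \<sigma>\<^sub>s \<theta>\<^sub>0}"
  note D = discriminant_sign_iff[OF assms]
  \<comment> \<open>This description precedes any use of the bound on
    \<open>\<sigma>\<^sub>s\<close>, so it serves both for the necessity of the bound and for the
    list of solutions.\<close>
  have S: "?S = {quad_phase m \<mu>\<^sub>0 \<sigma>\<^sub>0 a (u_star T \<mu>\<^sub>0 \<mu>\<^sub>s) c\<^sub>0 | a c\<^sub>0. (\<sigma>\<^sub>0 + a * T)\<^sup>2 = ?D}"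
    using assms reaches_quad_phase_iff[of m T \<sigma>\<^sub>0 \<sigma>\<^sub>s \<mu>\<^sub>0 \<mu>\<^sub>s]
    unfolding is_quad_phase_def by (auto; blast)
  have char: "?S = {quad_phase m \<mu>\<^sub>0 \<sigma>\<^sub>0 a (u_star T \<mu>\<^sub>0 \<mu>\<^sub>s) c\<^sub>0 | a c\<^sub>0.
      a = a_star_plus m T \<sigma>\<^sub>0 \<sigma>\<^sub>s \<or> a = a_star_minus m T \<sigma>\<^sub>0 \<sigma>\<^sub>s}"
    if "\<sigma>\<^sub>s \<ge> T / (2 * m * \<sigma>\<^sub>0)"
    unfolding S using that assms a_star_iff D(1) by presburger
  have "?S \<noteq> {} \<longleftrightarrow> \<sigma>\<^sub>s \<ge> T / (2 * m * \<sigma>\<^sub>0)"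
  proof
    assume "?S \<noteq> {}"
    then obtain a where "(\<sigma>\<^sub>0 + a * T)\<^sup>2 = ?D" unfolding S by blast
    then show "\<sigma>\<^sub>s \<ge> T / (2 * m * \<sigma>\<^sub>0)" using D(1) by (metis zero_le_power2)
  qed (subst char, auto)
  \<comment> \<open>The two coefficients differ by \<open>2 / T * sqrt ?D\<close>, so this
    equivalence settles the strict case and the case of equality at once.\<close>
  moreover have "a_star_plus m T \<sigma>\<^sub>0 \<sigma>\<^sub>s = a_star_minus m T \<sigma>\<^sub>0 \<sigma>\<^sub>s \<longleftrightarrow> ?D = 0"
    using assms by (simp add: a_star_plus_def a_star_minus_def)
  ultimately show ?thesis using char D(2) by auto
qed

end
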